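(* Let $H$ be a real Hilbert space with zero vector $\theta$, let $r>0$, let $r\mathbb{B}=\{x\in H:\|x\|\le r\}$, and let $P_{r\mathbb{B}}:H\to r\mathbb{B}$ be the metric projection onto $r\mathbb{B}$. The regular coderivative of $P_{r\mathbb{B}}$ at a point $\bar{x}\in H$ is given as follows. (i) If $\|\bar{x}\|<r$ (i.e. $\bar{x}$ is in the interior of $r\mathbb{B}$), then $\widehat{D}^\ast P_{r\mathbb{B}}(\bar{x})(y)=\{y\}$ for every $y\in H$. (ii) If $\bar{x}\in H\setminus r\mathbb{B}$, then $$\widehat{D}^\ast P_{r\mathbb{B}}(\bar{x})(y)=\left\{\frac{r}{\|\bar{x}\|}\Big(y-\frac{\langle \bar{x},y\rangle}{\|\bar{x}\|^2}\bar{x}\Big)\right\}\quad\text{for every } y\in H.$$ (iii) If $\|\bar{x}\|=r$ (i.e. $\bar{x}$ is in the boundary of $r\mathbb{B}$), then for every $y\in H$ $$\widehat{D}^\ast P_{r\mathbb{B}}(\bar{x})(y)=\left\{z\in H:\ \langle y,\bar{x}\rangle\le\langle z,\bar{x}\rangle\le 0,\ \ y-z=\frac{\langle y-z,\bar{x}\rangle}{\|\bar{x}\|^2}\bar{x}\right\}.$$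
   Context: For a nonempty closed convex set $C\subset H$, $P_C(x)$ is the unique point $y\in C$ with $\|x-y\|=\inf_{w\in C}\|x-w\|$. For a nonempty subset $\Omega$ of a Hilbert space $K$ and $\bar{p}\in\Omega$, the (Fréchet) regular normal cone is $$\widehat{N}_\Omega(\bar{p})=\Big\{q\in K:\ \limsup_{p\to\bar{p},\ p\in\Omega}\frac{\langle q,p-\bar{p}\rangle}{\|p-\bar{p}\|}\le 0\Big\}$$ (limsup over $p\ne\bar p$), with $\widehat N_\Omega(\bar p)=\emptyset$ if $\bar p\notin\Omega$. $H\times H$ carries the inner product $\langle(x,y),(u,v)\rangle=\langle x,u\rangle+\langle y,v\rangle$ and the induced norm $\|(x,y)\|=\sqrt{\|x\|^2+\|y\|^2}$. For a single-valued mapping $f:H\to H$ with graph $\mathrm{gph}\,f=\{(x,f(x)):x\in H\}\subset H\times H$, the (Fréchet) regular coderivative of $f$ at $\bar{x}$ is the set-valued mapping $$\widehat{D}^\ast f(\bar{x})(w)=\{v\in H:\ (v,-w)\in\widehat{N}_{\mathrm{gph}\,f}(\bar{x},f(\bar{x}))\},\quad w\in H.$$ *)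

theory Defs
  imports "HOL-Analysis.Analysis"
begin

(* The library's closest_point is confined to the class heine_borel, i.e. to finite
   dimension, so the projection is defined here for arbitrary real Hilbert spaces.
   THE is meaningful when C is nonempty, closed and convex. *)
definition metric_proj :: "'a::{real_inner,complete_space} set \<Rightarrow> 'a \<Rightarrow> 'a" where
  "metric_proj C x = (THE y. y \<in> C \<and> norm (x - y) = (INF w\<in>C. norm (x - w)))"

(* The filter (at p within \<Omega>) excludes p itself.  The upper limit is taken in the extended
   reals; at an isolated point of \<Omega> it is -\<infinity>, and the cone is then the whole space. *)
definition regular_normal_cone ::
    "'k::{real_inner,complete_space} set \<Rightarrow> 'k \<Rightarrow> 'k set" where
  "regular_normal_cone \<Omega> p =
     (if p \<in> \<Omega>
      then {q. Limsup (at p within \<Omega>) (\<lambda>u. ereal (inner q (u - p) / norm (u - p))) \<le> 0}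
      else {})"

definition gph :: "('a \<Rightarrow> 'b) \<Rightarrow> ('a \<times> 'b) set" where
  "gph f = {(x, f x) |x. True}"

(* The library's inner product and norm on 'a \<times> 'a are the Hilbert product ones
   (inner_prod_def, norm_prod_def). *)
definition regular_coderivative ::
    "('a::{real_inner,complete_space} \<Rightarrow> 'a) \<Rightarrow> 'a \<Rightarrow> 'a \<Rightarrow> 'a set" where
  "regular_coderivative f x w = {v. (v, - w) \<in> regular_normal_cone (gph f) (x, f x)}"

end

theory Submission
  imports Defs
begin

text \<open>
  A Lipschitz-type bound lets one replace the norm on the graph by the norm of the first component
  in the definition of the coderivative.  If in addition \<open>f\<close> has a positively homogeneous
  first-order approximation \<open>D\<close> at \<open>x\<close> (its Bouligand derivative), testing along rays shows
  that \<open>z\<close> belongs to the coderivative at \<open>y\<close> iff \<open>\<langle>z, h\<rangle> \<le> \<langle>y, D h\<rangle>\<close> for all \<open>h\<close>.  For the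
  projection onto a ball, \<open>D\<close> is the identity inside, the derivative of \<open>u \<mapsto> r u / \<parallel>u\<parallel>\<close> outside,
  and \<open>h - max 0 \<langle>h, x\<rangle> x / r\<^sup>2\<close> on the sphere.
\<close>

section \<open>The coderivative through first-order approximations\<close>

lemma regular_coderivative_iff:
  fixes f :: "'a::{real_inner,complete_space} \<Rightarrow> 'a"
  assumes "d0 > 0" "L \<ge> 0" and lip: "\<And>u. norm (u - x) < d0 \<Longrightarrow> norm (f u - f x) \<le> L * norm (u - x)"
  shows "z \<in> regular_coderivative f x y \<longleftrightarrow>
    (\<forall>e>0. \<exists>d>0. \<forall>u. norm (u - x) < d \<longrightarrow> inner z (u - x) - inner y (f u - f x) \<le> e * norm (u - x))"
    (is "_ \<longleftrightarrow> ?R")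
proof -
  let ?q = "\<lambda>p. inner (z, - y) (p - (x, f x)) / norm (p - (x, f x))"
  have "z \<in> regular_coderivative f x y \<longleftrightarrow>
      Limsup (at (x, f x) within gph f) (\<lambda>p. ereal (?q p)) \<le> 0"
    by (auto simp: regular_coderivative_def regular_normal_cone_def gph_def)
  also have "\<dots> \<longleftrightarrow> (\<forall>e>0. eventually (\<lambda>p. ?q p < e) (at (x, f x) within gph f))"
  proof
    assume "Limsup (at (x, f x) within gph f) (\<lambda>p. ereal (?q p)) \<le> 0"
    then have *: "\<forall>c>0. eventually (\<lambda>p. ereal (?q p) < c) (at (x, f x) within gph f)"
      by (simp add: Limsup_le_iff)
    show "\<forall>e>0. eventually (\<lambda>p. ?q p < e) (at (x, f x) within gph f)"
    proof (intro allI impI)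
      fix e :: real assume "e > 0"
      then show "eventually (\<lambda>p. ?q p < e) (at (x, f x) within gph f)"
        using *[rule_format, of "ereal e"] by simp
    qed
  next
    assume *: "\<forall>e>0. eventually (\<lambda>p. ?q p < e) (at (x, f x) within gph f)"
    show "Limsup (at (x, f x) within gph f) (\<lambda>p. ereal (?q p)) \<le> 0"
      unfolding Limsup_le_iff
    proof (intro allI impI)
      fix c :: ereal assume "0 < c"
      \<comment> \<open>\<open>c\<close> may be infinite, so a real threshold is interposed before
        the real-valued hypothesis is used.\<close>
      then obtain e where e: "0 < ereal e" "ereal e < c" using ereal_dense2 by blast
      then have "eventually (\<lambda>p. ?q p < e) (at (x, f x) within gph f)" using * by simp
      then show "eventually (\<lambda>p. ereal (?q p) < c) (at (x, f x) within gph f)"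
        by eventually_elim (use e in \<open>meson ereal_less(2) less_ereal.simps(1) less_trans\<close>)
    qed
  qed
  also have "\<dots> \<longleftrightarrow> ?R"
  proof
    assume *: "\<forall>e>0. eventually (\<lambda>p. ?q p < e) (at (x, f x) within gph f)"
    show ?R
    proof (intro allI impI)
      fix e :: real assume "e > 0"
      \<comment> \<open>Near \<open>x\<close> the graph norm is at most
        \<open>(1 + L) * norm (u - x)\<close>. Dividing both the tolerance and the radius by
        \<open>1 + L\<close> absorbs this factor.\<close>
      then have e': "e / (1 + L) > 0" using assms by simp
      obtain d where d: "d > 0" "\<And>p. p \<in> gph f \<Longrightarrow> p \<noteq> (x, f x) \<Longrightarrow> dist p (x, f x) < d
          \<Longrightarrow> ?q p < e / (1 + L)"
        using *[rule_format, OF e'] unfolding eventually_at by blast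
      show "\<exists>d>0. \<forall>u. norm (u - x) < d \<longrightarrow> inner z (u - x) - inner y (f u - f x) \<le> e * norm (u - x)"
      proof (intro exI conjI allI impI)
        show "min d0 (d / (1 + L)) > 0" using assms d by simp
        fix u assume u: "norm (u - x) < min d0 (d / (1 + L))"
        show "inner z (u - x) - inner y (f u - f x) \<le> e * norm (u - x)"
        \<comment> \<open>The punctured filter says nothing about the base point; there both sides
          vanish.\<close>
        proof (cases "u = x")
          case False
          let ?n = "norm ((u, f u) - (x, f x))"
          have "?n \<le> norm (u - x) + norm (f u - f x)"
            by (simp add: norm_Pair sqrt_sum_squares_le_sum)
          also have "\<dots> \<le> norm (u - x) + L * norm (u - x)" using lip u by simp
          finally have n: "?n \<le> (1 + L) * norm (u - x)" by (simp add: algebra_simps)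
          also have "\<dots> < d" using u assms by (simp add: field_simps)
          finally have "?q (u, f u) < e / (1 + L)"
            using False by (intro d) (auto simp: gph_def dist_norm)
          moreover have "?n > 0" using False by (simp add: zero_prod_def)
          ultimately have "inner (z, - y) ((u, f u) - (x, f x)) < e / (1 + L) * ?n"
            by (simp add: divide_less_eq)
          also have "\<dots> \<le> e / (1 + L) * ((1 + L) * norm (u - x))"
            using n e' by (intro mult_left_mono) auto
          also have "\<dots> = e * norm (u - x)" using assms by simp
          finally show ?thesis by simp
        qed simp
      qed
    qed
  next
    assume R: ?R
    show "\<forall>e>0. eventually (\<lambda>p. ?q p < e) (at (x, f x) within gph f)"
    proof (intro allI impI)
      fix e :: real assume "e > 0"
      \<comment> \<open>Half the tolerance, so that the non-strict bound becomes strict at the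
        end.\<close>
      then obtain d where d: "d > 0" "\<And>u. norm (u - x) < d \<Longrightarrow>
          inner z (u - x) - inner y (f u - f x) \<le> e / 2 * norm (u - x)"
        using R[rule_format, of "e / 2"] by auto
      show "eventually (\<lambda>p. ?q p < e) (at (x, f x) within gph f)"
        unfolding eventually_at
      proof (intro exI conjI ballI impI)
        fix p assume "p \<in> gph f" and p: "p \<noteq> (x, f x) \<and> dist p (x, f x) < d"
        then obtain u where u: "p = (u, f u)" by (auto simp: gph_def)
        let ?n = "norm (p - (x, f x))"
        have le: "norm (u - x) \<le> ?n" by (simp add: u norm_Pair real_le_rsqrt)
        have n: "?n > 0" using p by simp
        have "norm (u - x) < d" using le p by (simp add: dist_norm)
        then have "inner (z, - y) (p - (x, f x)) \<le> e / 2 * norm (u - x)"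
          using d(2) by (simp add: u)
        also have "\<dots> \<le> e / 2 * ?n" using le \<open>e > 0\<close> by simp
        also have "\<dots> < e * ?n" using n \<open>e > 0\<close> by simp
        finally show "?q p < e" using n by (simp add: divide_less_eq)
      qed (rule d)
    qed
  qed
  finally show ?thesis .
qed

text \<open>Replacing the increment of \<open>f\<close> by \<open>D (u - x)\<close> costs only
  o(\<open>norm (u - x)\<close>), so membership says that \<open>inner z h - inner y (D h)\<close>
  is bounded above by an o(\<open>norm h\<close>) as \<open>h\<close> tends to 0. This expression is
  positively homogeneous in \<open>h\<close>, which forces it to be nonpositive everywhere. Only
  positive scaling enters, so the nonlinear \<open>D\<close> arising on the sphere is
  covered.\<close>

lemma regular_coderivative_eq:
  fixes f D :: "'a::{real_inner,complete_space} \<Rightarrow> 'a"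
  assumes approx: "\<And>e. e > 0 \<Longrightarrow> \<exists>d>0. \<forall>u. norm (u - x) < d \<longrightarrow>
      norm (f u - f x - D (u - x)) \<le> e * norm (u - x)"
    and bound: "\<And>h. norm (D h) \<le> L * norm h"
    and hom: "\<And>t h. t > 0 \<Longrightarrow> D (t *\<^sub>R h) = t *\<^sub>R D h"
  shows "regular_coderivative f x y = {z. \<forall>h. inner z h \<le> inner y (D h)}"
proof -
  \<comment> \<open>\<open>L\<close> carries no sign condition, while the Lipschitz constant passed
    on has to be nonnegative.\<close>
  have bound': "norm (D h) \<le> \<bar>L\<bar> * norm h" for h
    by (rule order_trans[OF bound]) (simp add: mult_right_mono)
  obtain d0 where d0: "d0 > 0" "\<And>u. norm (u - x) < d0 \<Longrightarrow> norm (f u - f x - D (u - x)) \<le> 1 * norm (u - x)"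
    using approx[of 1] by auto
  have lip: "norm (f u - f x) \<le> (1 + \<bar>L\<bar>) * norm (u - x)" if "norm (u - x) < d0" for u
    using d0(2)[OF that] bound'[of "u - x"] norm_triangle_sub[of "f u - f x" "D (u - x)"]
    by (simp add: algebra_simps)
  note iff = regular_coderivative_iff[where x = x and f = f and L = "1 + \<bar>L\<bar>", OF d0(1) _ lip, simplified]
  \<comment> \<open>Cauchy-Schwarz multiplies the approximation error by \<open>norm y\<close>;
    dividing by \<open>1 + norm y\<close> compensates and stays meaningful for
    \<open>y = 0\<close>.\<close>
  have err: "\<bar>inner y (f u - f x) - inner y (D (u - x))\<bar> \<le> e * norm (u - x)"
    if "norm (f u - f x - D (u - x)) \<le> e / (1 + norm y) * norm (u - x)" "e > 0" for u e
  proof -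
    have "\<bar>inner y (f u - f x - D (u - x))\<bar> \<le> norm y * norm (f u - f x - D (u - x))"
      by (rule Cauchy_Schwarz_ineq2)
    also have "\<dots> \<le> (1 + norm y) * (e / (1 + norm y) * norm (u - x))"
      using that by (intro mult_mono) auto
    also have "\<dots> = e * norm (u - x)"
      using norm_ge_zero[of y] by (simp add: add_nonneg_eq_0_iff)
    finally show ?thesis by (simp add: inner_diff_right)
  qed
  have pos: "e / (1 + norm y) > 0" if "e > 0" for e
    using that by (simp add: add_pos_nonneg)
  show ?thesis
  proof (intro equalityI subsetI CollectI allI)
    fix z h assume z: "z \<in> regular_coderivative f x y"
    show "inner z h \<le> inner y (D h)"
    proof (rule field_le_epsilon)
      fix c :: real assume c: "c > 0"
      \<comment> \<open>Two errors of size \<open>e * norm h\<close>, one from the coderivative and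
        one from the approximation, must add up to at most \<open>c\<close>. The summand
        \<open>1\<close> covers \<open>h = 0\<close>.\<close>
      define e where "e = c / 2 / (1 + norm h)"
      have "1 + norm h \<noteq> 0" using norm_ge_zero[of h] by linarith
      then have e1: "e * (1 + norm h) = c / 2"
        unfolding e_def by (rule nonzero_eq_divide_eq[THEN iffD1]) simp
      have e: "e > 0" unfolding e_def using c by (simp add: add_pos_nonneg)
      obtain d1 where d1: "d1 > 0" "\<And>u. norm (u - x) < d1 \<Longrightarrow>
          inner z (u - x) - inner y (f u - f x) \<le> e * norm (u - x)"
        using z e unfolding iff by blast
      obtain d2 where d2: "d2 > 0" "\<And>u. norm (u - x) < d2 \<Longrightarrow>
          norm (f u - f x - D (u - x)) \<le> e / (1 + norm y) * norm (u - x)"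
        using approx[OF pos[OF e]] by blast
      \<comment> \<open>Places \<open>x + t *\<^sub>R h\<close> within both radii; homogeneity later
        cancels \<open>t\<close>.\<close>
      define t where "t = min d1 d2 / (1 + norm h)"
      have t: "t > 0" unfolding t_def using d1 d2 by (simp add: add_pos_nonneg)
      have "t * norm h < t * (1 + norm h)" using t by simp
      also have "\<dots> = min d1 d2" unfolding t_def
        using norm_ge_zero[of h] by (simp add: add_nonneg_eq_0_iff)
      finally have small: "norm ((x + t *\<^sub>R h) - x) < min d1 d2" using t by simp
      have "inner z ((x + t *\<^sub>R h) - x) - inner y (D ((x + t *\<^sub>R h) - x)) \<le> 2 * e * norm ((x + t *\<^sub>R h) - x)"
        using d1(2)[of "x + t *\<^sub>R h"] err[OF d2(2) e, of "x + t *\<^sub>R h"] small by simp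
      then have "t * (inner z h - inner y (D h)) \<le> t * (2 * e * norm h)"
        using t by (simp add: hom algebra_simps)
      then have "inner z h - inner y (D h) \<le> 2 * e * norm h" using t by simp
      also have "\<dots> \<le> 2 * e * (1 + norm h)" using e by simp
      also have "\<dots> = c" using e1 by simp
      finally show "inner z h \<le> inner y (D h) + c" by simp
    qed
  next
    fix z assume z: "z \<in> {z. \<forall>h. inner z h \<le> inner y (D h)}"
    show "z \<in> regular_coderivative f x y"
      unfolding iff
    proof (intro allI impI)
      fix e :: real assume e: "e > 0"
      obtain d where d: "d > 0" "\<And>u. norm (u - x) < d \<Longrightarrow>
          norm (f u - f x - D (u - x)) \<le> e / (1 + norm y) * norm (u - x)"
        using approx[OF pos[OF e]] by blast
      have "inner z (u - x) - inner y (f u - f x) \<le> e * norm (u - x)" if "norm (u - x) < d" for u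
      proof -
        have "inner z (u - x) \<le> inner y (D (u - x))" using z by simp
        then show ?thesis using err[OF d(2)[OF that] e] by simp
      qed
      then show "\<exists>d>0. \<forall>u. norm (u - x) < d \<longrightarrow>
          inner z (u - x) - inner y (f u - f x) \<le> e * norm (u - x)"
        using d(1) by blast
    qed
  qed
qed

section \<open>The metric projection onto a ball\<close>

text \<open>Expanding the square around \<open>y\<close>, the obtuse-angle condition yields the
  Pythagorean inequality \<open>sq\<close>. Its extra term \<open>(norm (w - y))\<^sup>2\<close>
  gives minimality and uniqueness at once, hence both the infimum and the
  \<open>THE\<close>.\<close>

lemma metric_proj_eqI:
  fixes C :: "'a::{real_inner,complete_space} set"
  assumes "y \<in> C" and angle: "\<And>w. w \<in> C \<Longrightarrow> inner (x - y) (w - y) \<le> 0"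
  shows "metric_proj C x = y"
proof -
  have sq: "(norm (x - y))\<^sup>2 + (norm (w - y))\<^sup>2 \<le> (norm (x - w))\<^sup>2" if "w \<in> C" for w
  proof -
    have "(norm (a - b))\<^sup>2 = (norm a)\<^sup>2 - 2 * inner a b + (norm b)\<^sup>2" for a b :: 'a
      by (simp add: power2_norm_eq_inner inner_diff_left inner_diff_right inner_commute)
    from this[of "x - y" "w - y"]
    have "(norm (x - w))\<^sup>2 = (norm (x - y))\<^sup>2 - 2 * inner (x - y) (w - y) + (norm (w - y))\<^sup>2"
      by simp
    then show ?thesis using angle[OF that] by simp
  qed
  have le: "norm (x - y) \<le> norm (x - w)" if "w \<in> C" for w
    using sq[OF that] zero_le_power2[of "norm (w - y)"]
    by - (rule power2_le_imp_le, linarith, rule norm_ge_zero)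
  have inf: "(INF w\<in>C. norm (x - w)) = norm (x - y)"
    using assms(1) le by (intro cInf_eq_minimum) auto
  show ?thesis
    unfolding metric_proj_def inf
  proof (rule the_equality)
    fix w assume w: "w \<in> C \<and> norm (x - w) = norm (x - y)"
    then have "(norm (w - y))\<^sup>2 \<le> 0" using sq[of w] by simp
    then show "w = y" by simp
  qed (use assms in simp)
qed

lemma metric_proj_inside: "norm x \<le> r \<Longrightarrow> metric_proj (cball 0 r) x = x"
  by (rule metric_proj_eqI) auto

text \<open>The residual is a nonnegative multiple of \<open>x\<close>, and by Cauchy-Schwarz
  \<open>inner x w\<close> is maximal over the ball at the rescaled point, so the angle condition
  holds.\<close>

lemma metric_proj_outside:
  assumes "r > 0" "norm x \<ge> r"
  shows "metric_proj (cball 0 r) x = (r / norm x) *\<^sub>R x"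
proof (rule metric_proj_eqI)
  fix w assume "w \<in> cball (0::'a) r"
  then have w: "norm w \<le> r" by simp
  have n: "norm x > 0" using assms by linarith
  have "inner x w \<le> norm x * r"
    using w by (intro order_trans[OF norm_cauchy_schwarz]) (simp add: mult_left_mono)
  moreover have "inner x ((r / norm x) *\<^sub>R x) = norm x * r"
    using n by (simp add: dot_square_norm power2_eq_square)
  ultimately have "inner x (w - (r / norm x) *\<^sub>R x) \<le> 0"
    by (simp add: inner_diff_right)
  moreover have "x - (r / norm x) *\<^sub>R x = (1 - r / norm x) *\<^sub>R x"
    by (simp add: algebra_simps)
  moreover have "1 - r / norm x \<ge> 0" using n assms by simp
  ultimately show "inner (x - (r / norm x) *\<^sub>R x) (w - (r / norm x) *\<^sub>R x) \<le> 0"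
    by (simp add: mult_nonneg_nonpos)
qed (use assms in auto)

section \<open>First-order behaviour of the radial map\<close>

text \<open>The map is constant along rays from the origin, so its derivative annihilates
  \<open>x\<close>. The component of \<open>h\<close> orthogonal to \<open>x\<close> is merely
  scaled.\<close>

lemma has_derivative_radial:
  fixes x :: "'a::real_inner"
  assumes "x \<noteq> 0"
  shows "((\<lambda>u. (r / norm u) *\<^sub>R u) has_derivative
    (\<lambda>h. (r / norm x) *\<^sub>R (h - (inner x h / (norm x)\<^sup>2) *\<^sub>R x))) (at x)"
proof -
  have "((\<lambda>u. (r * inverse (norm u)) *\<^sub>R u) has_derivative
    (\<lambda>h. (r * inverse (norm x)) *\<^sub>R h
       + (r * - (inverse (norm x) * inner h (sgn x) * inverse (norm x))) *\<^sub>R x)) (at x)"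
    using assms by (auto intro!: derivative_eq_intros has_derivative_norm)
  then have "((\<lambda>u. (r / norm u) *\<^sub>R u) has_derivative
    (\<lambda>h. (r * inverse (norm x)) *\<^sub>R h
       + (r * - (inverse (norm x) * inner h (sgn x) * inverse (norm x))) *\<^sub>R x)) (at x)"
    by (simp only: divide_inverse)
  then show ?thesis
    by (rule has_derivative_eq_rhs)
      (use assms in \<open>simp add: fun_eq_iff sgn_div_norm inner_commute scaleR_right_diff_distrib
        field_simps power2_eq_square\<close>)
qed

lemma radial_approx:
  fixes x :: "'a::real_inner"
  assumes "x \<noteq> 0" "e > 0"
  shows "\<exists>d>0. \<forall>u. norm (u - x) < d \<longrightarrow>
    norm ((r / norm u) *\<^sub>R u - (r / norm x) *\<^sub>R x
      - (r / norm x) *\<^sub>R ((u - x) - (inner x (u - x) / (norm x)\<^sup>2) *\<^sub>R x)) \<le> e * norm (u - x)"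
  using has_derivative_radial[OF assms(1), of r] assms(2) unfolding has_derivative_at_alt by blast

text \<open>Supplies the \<open>bound\<close> premise of \<open>regular_coderivative_eq\<close>; the
  crude constant 2 from the triangle inequality is enough for that.\<close>

lemma norm_projection_orthogonal_le:
  fixes x h :: "'a::real_inner"
  shows "norm (h - (inner x h / (norm x)\<^sup>2) *\<^sub>R x) \<le> 2 * norm h"
proof (cases "x = 0")
  case False
  have "norm ((inner x h / (norm x)\<^sup>2) *\<^sub>R x) = \<bar>inner x h\<bar> / norm x"
    using False by (simp add: power2_eq_square)
  also have "\<dots> \<le> norm h"
    using False Cauchy_Schwarz_ineq2[of x h] by (simp add: divide_le_eq mult.commute)
  finally show ?thesis
    using norm_triangle_ineq4[of h "(inner x h / (norm x)\<^sup>2) *\<^sub>R x"] by simp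
qed simp

section \<open>The three positions of the base point\<close>

lemma regular_coderivative_proj_inside:
  fixes x :: "'a::{real_inner,complete_space}"
  assumes "norm x < r"
  shows "regular_coderivative (metric_proj (cball 0 r)) x y = {y}"
proof -
  let ?P = "metric_proj (cball (0::'a) r)"
  have "regular_coderivative ?P x y = {z. \<forall>h. inner z h \<le> inner y h}"
  proof (rule regular_coderivative_eq[where D = "\<lambda>h. h" and L = 1])
    fix e :: real assume "e > 0"
    have "?P u - ?P x - (u - x) = 0" if "norm (u - x) < r - norm x" for u
    proof -
      have "norm u \<le> r" using that norm_triangle_sub[of u x] by simp
      then show ?thesis using assms by (simp add: metric_proj_inside)
    qed
    then show "\<exists>d>0. \<forall>u. norm (u - x) < d \<longrightarrow> norm (?P u - ?P x - (u - x)) \<le> e * norm (u - x)"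
      using assms \<open>e > 0\<close> by (intro exI[of _ "r - norm x"]) auto
  qed auto
  also have "\<dots> = {y}"
  proof (intro equalityI subsetI)
    fix z assume "z \<in> {z. \<forall>h. inner z h \<le> inner y h}"
    \<comment> \<open>The test direction is \<open>h = z - y\<close>.\<close>
    then have "inner (z - y) (z - y) \<le> 0" by (simp only: inner_diff_left) simp
    then show "z \<in> {y}" by (metis inner_gt_zero_iff not_le right_minus_eq singletonI)
  qed simp
  finally show ?thesis .
qed

lemma regular_coderivative_proj_outside:
  fixes x :: "'a::{real_inner,complete_space}"
  assumes "r > 0" "norm x > r"
  shows "regular_coderivative (metric_proj (cball 0 r)) x y =
    {(r / norm x) *\<^sub>R (y - (inner x y / (norm x)\<^sup>2) *\<^sub>R x)}"
proof -
  let ?P = "metric_proj (cball (0::'a) r)"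
  let ?D = "\<lambda>h. (r / norm x) *\<^sub>R (h - (inner x h / (norm x)\<^sup>2) *\<^sub>R x)"
  have "x \<noteq> 0" using assms by auto
  have "regular_coderivative ?P x y = {z. \<forall>h. inner z h \<le> inner y (?D h)}"
  proof (rule regular_coderivative_eq[where D = ?D and L = "r / norm x * 2"])
    fix e :: real assume "e > 0"
    then obtain d where d: "d > 0" "\<And>u. norm (u - x) < d \<Longrightarrow>
        norm ((r / norm u) *\<^sub>R u - (r / norm x) *\<^sub>R x - ?D (u - x)) \<le> e * norm (u - x)"
      using radial_approx[OF \<open>x \<noteq> 0\<close>, of e r] by blast
    have "norm (?P u - ?P x - ?D (u - x)) \<le> e * norm (u - x)"
      if "norm (u - x) < min d (norm x - r)" for u
    proof -
      have "norm u \<ge> r" using that norm_triangle_sub[of x u] by (simp add: norm_minus_commute)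
      then show ?thesis using d(2)[of u] that assms by (simp add: metric_proj_outside)
    qed
    then show "\<exists>d>0. \<forall>u. norm (u - x) < d \<longrightarrow> norm (?P u - ?P x - ?D (u - x)) \<le> e * norm (u - x)"
      using assms d(1) by (intro exI[of _ "min d (norm x - r)"]) auto
  next
    fix h
    have "r / norm x * norm (h - (inner x h / (norm x)\<^sup>2) *\<^sub>R x) \<le> r / norm x * (2 * norm h)"
      using assms by (intro mult_left_mono norm_projection_orthogonal_le) auto
    then show "norm (?D h) \<le> r / norm x * 2 * norm h" using assms by simp
  qed (simp add: algebra_simps)
  also have "\<dots> = {?D y}"
  proof -
    \<comment> \<open>\<open>?D\<close> is self-adjoint, so the condition compares \<open>z\<close>
      with \<open>?D y\<close> in every direction; the direction \<open>z - ?D y\<close> then forces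
      equality.\<close>
    have sym: "inner y (?D h) = inner (?D y) h" for h
      by (simp add: inner_diff_left inner_diff_right inner_commute)
    have "z = ?D y" if "\<And>h. inner z h \<le> inner (?D y) h" for z
    proof -
      have "inner (z - ?D y) (z - ?D y) \<le> 0"
        using that[of "z - ?D y"] by (simp only: inner_diff_left[of z] diff_le_0_iff_le)
      then show ?thesis by (metis inner_gt_zero_iff not_le right_minus_eq)
    qed
    then show ?thesis unfolding sym by blast
  qed
  finally show ?thesis .
qed

text \<open>The condition on all \<open>h\<close> splits by the sign of \<open>inner x h\<close>: on
  one half-space \<open>?D\<close> is the identity, on the other the tangential projection
  \<open>?T\<close>. The first half makes \<open>y - z\<close> a nonpositive multiple of
  \<open>x\<close>; the second yields the sign of \<open>inner z x\<close>.\<close>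

lemma regular_coderivative_proj_boundary:
  fixes x :: "'a::{real_inner,complete_space}"
  assumes "r > 0" "norm x = r"
  shows "regular_coderivative (metric_proj (cball 0 r)) x y =
    {z. inner y x \<le> inner z x \<and> inner z x \<le> 0 \<and>
        y - z = (inner (y - z) x / (norm x)\<^sup>2) *\<^sub>R x}"
proof -
  let ?P = "metric_proj (cball (0::'a) r)"
  let ?D = "\<lambda>h. h - (max 0 (inner x h) / (norm x)\<^sup>2) *\<^sub>R x"
  let ?T = "\<lambda>h. h - (inner x h / (norm x)\<^sup>2) *\<^sub>R x"
  have "x \<noteq> 0" using assms by auto
  have xx: "inner x x = r\<^sup>2" using assms by (simp add: dot_square_norm)
  have Px: "?P x = x" using assms by (simp add: metric_proj_inside)
  have square: "(norm u)\<^sup>2 = r\<^sup>2 + 2 * inner x (u - x) + (norm (u - x))\<^sup>2" for u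
    using xx by (simp add: power2_norm_eq_inner inner_diff_left inner_diff_right inner_commute)
  have "regular_coderivative ?P x y = {z. \<forall>h. inner z h \<le> inner y (?D h)}"
  proof (rule regular_coderivative_eq[where D = ?D and L = 2])
    fix e :: real assume e: "e > 0"
    then obtain d where d: "d > 0" "\<And>u. norm (u - x) < d \<Longrightarrow>
        norm ((r / norm u) *\<^sub>R u - (r / norm x) *\<^sub>R x - (r / norm x) *\<^sub>R ?T (u - x)) \<le> e / 2 * norm (u - x)"
      using radial_approx[OF \<open>x \<noteq> 0\<close>, of "e / 2" r] by auto
    \<comment> \<open>The radius \<open>e * r\<close> turns the quadratic curvature error in the
      outside case into \<open>e / 2 * norm (u - x)\<close>; the other half of \<open>e\<close> goes
      to the radial approximation.\<close>
    have "norm (?P u - ?P x - ?D (u - x)) \<le> e * norm (u - x)"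
      if u: "norm (u - x) < min d (e * r)" for u
    proof (cases "norm u \<le> r")
      case True
      then have "(norm u)\<^sup>2 \<le> r\<^sup>2" by (simp add: power_mono)
      then have "inner x (u - x) \<le> 0" using square[of u] zero_le_power2[of "norm (u - x)"] by linarith
      then have "?P u - ?P x - ?D (u - x) = 0"
        using True by (simp add: Px metric_proj_inside)
      then show ?thesis using e by simp
    next
      case False
      \<comment> \<open>Outside the ball \<open>inner x (u - x)\<close> can still be slightly
        negative, because the sphere curves away from its tangent plane. \<open>?m\<close> measures
        the resulting gap between \<open>?D\<close> and \<open>?T\<close>, and \<open>square\<close>
        shows that it is of second order.\<close>
      let ?m = "min 0 (inner x (u - x))"
      have "r\<^sup>2 < (norm u)\<^sup>2" using False assms by (simp add: power_strict_mono)
      then have m: "\<bar>?m\<bar> \<le> (norm (u - x))\<^sup>2 / 2"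
        using square[of u] zero_le_power2[of "norm (u - x)"] by linarith
      have "norm ((?m / (norm x)\<^sup>2) *\<^sub>R x) = \<bar>?m\<bar> / r"
        using assms by (simp add: power2_eq_square)
      also have "\<dots> \<le> norm (u - x) * norm (u - x) / (2 * r)"
        using m assms by (simp add: field_simps power2_eq_square)
      also have "\<dots> \<le> (e * r) * norm (u - x) / (2 * r)"
        using u assms by (intro divide_right_mono mult_right_mono) auto
      also have "\<dots> = e / 2 * norm (u - x)" using assms by simp
      finally have 1: "norm ((?m / (norm x)\<^sup>2) *\<^sub>R x) \<le> e / 2 * norm (u - x)" .
      have "max 0 (inner x (u - x)) = inner x (u - x) - ?m" by simp
      then have "?D (u - x) = ?T (u - x) + (?m / (norm x)\<^sup>2) *\<^sub>R x"
        by (simp only: diff_divide_distrib scaleR_left_diff_distrib) simp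
      moreover have "?P u = (r / norm u) *\<^sub>R u"
        using assms False by (simp add: metric_proj_outside)
      ultimately have "?P u - ?P x - ?D (u - x) =
          ((r / norm u) *\<^sub>R u - (r / norm x) *\<^sub>R x - (r / norm x) *\<^sub>R ?T (u - x))
            - (?m / (norm x)\<^sup>2) *\<^sub>R x"
        using assms Px by simp
      then have "norm (?P u - ?P x - ?D (u - x)) \<le>
          norm ((r / norm u) *\<^sub>R u - (r / norm x) *\<^sub>R x - (r / norm x) *\<^sub>R ?T (u - x))
            + norm ((?m / (norm x)\<^sup>2) *\<^sub>R x)"
        by (simp only: norm_triangle_ineq4)
      also have "\<dots> \<le> e / 2 * norm (u - x) + e / 2 * norm (u - x)"
        using d(2) u 1 by (intro add_mono) auto
      finally show ?thesis by simp
    qed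
    then show "\<exists>d>0. \<forall>u. norm (u - x) < d \<longrightarrow> norm (?P u - ?P x - ?D (u - x)) \<le> e * norm (u - x)"
      using assms d(1) e by (intro exI[of _ "min d (e * r)"]) auto
  next
    fix h
    show "norm (?D h) \<le> 2 * norm h"
      using norm_projection_orthogonal_le[of h x] by (cases "inner x h \<ge> 0") auto
  next
    fix t :: real and h assume "t > 0"
    then have "max 0 (inner x (t *\<^sub>R h)) = t * max 0 (inner x h)"
      by (simp add: max_mult_distrib_left)
    then show "?D (t *\<^sub>R h) = t *\<^sub>R ?D h" by (simp add: scaleR_right_diff_distrib)
  qed
  also have "\<dots> = {z. inner y x \<le> inner z x \<and> inner z x \<le> 0 \<and>
      y - z = (inner (y - z) x / (norm x)\<^sup>2) *\<^sub>R x}"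
  proof (intro equalityI subsetI CollectI conjI allI)
    fix z assume "z \<in> {z. \<forall>h. inner z h \<le> inner y (?D h)}"
    then have z: "inner z h \<le> inner y (?D h)" for h by blast
    \<comment> \<open>On this half-space \<open>?D h = h\<close>. It contains both test directions
      used below, \<open>- x\<close> and \<open>?w\<close>.\<close>
    have zneg: "inner (z - y) h \<le> 0" if "inner x h \<le> 0" for h
      using z[of h] that by (simp add: inner_diff_left)
    show "inner y x \<le> inner z x"
      using zneg[of "- x"] xx by (simp add: inner_diff_left)
    have "?D x = 0" using xx assms by simp
    then show "inner z x \<le> 0" using z[of x] by simp
    \<comment> \<open>The component of \<open>z - y\<close> orthogonal to \<open>x\<close>. Testing
      with it bounds its own squared norm by zero.\<close>
    let ?w = "(z - y) - (inner (z - y) x / (norm x)\<^sup>2) *\<^sub>R x"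
    have orth: "inner x ?w = 0"
      using \<open>x \<noteq> 0\<close> by (simp add: inner_diff_right dot_square_norm inner_commute)
    have "inner ?w ?w = inner (z - y) ?w"
      using orth by (subst inner_diff_left) simp
    then have "inner ?w ?w \<le> 0" using zneg[of ?w] orth by simp
    then have "?w = 0" by (metis inner_gt_zero_iff not_le)
    then show "y - z = (inner (y - z) x / (norm x)\<^sup>2) *\<^sub>R x"
      by (simp add: inner_diff_left diff_divide_distrib scaleR_left_diff_distrib algebra_simps)
  next
    fix z h
    assume "z \<in> {z. inner y x \<le> inner z x \<and> inner z x \<le> 0 \<and>
      y - z = (inner (y - z) x / (norm x)\<^sup>2) *\<^sub>R x}"
    then have z: "inner y x \<le> inner z x" "inner z x \<le> 0"
      and eq: "y - z = (inner (y - z) x / (norm x)\<^sup>2) *\<^sub>R x" by auto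
    have diff: "inner y h - inner z h = (inner y x - inner z x) / r\<^sup>2 * inner x h"
      using arg_cong[OF eq, of "\<lambda>v. inner v h"] assms by (simp add: inner_diff_left)
    show "inner z h \<le> inner y (?D h)"
    proof (cases "inner x h \<le> 0")
      case True
      have "(inner y x - inner z x) / r\<^sup>2 \<le> 0"
        using z by (simp add: divide_nonpos_nonneg)
      then have "(inner y x - inner z x) / r\<^sup>2 * inner x h \<ge> 0"
        using True by (rule mult_nonpos_nonpos)
      then show ?thesis using True diff by simp
    next
      case False
      \<comment> \<open>The contribution of \<open>inner y x\<close> in \<open>diff\<close> cancels
        against the one removed by \<open>?D\<close>, so only the sign of \<open>inner z x\<close>
        matters here.\<close>
      have "inner y (?D h) - inner z h = - (inner z x / r\<^sup>2 * inner x h)"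
        using False diff assms by (simp add: inner_diff_right algebra_simps diff_divide_distrib)
      moreover have "inner z x / r\<^sup>2 * inner x h \<le> 0"
        using z False by (intro mult_nonpos_nonneg divide_nonpos_nonneg) auto
      ultimately show ?thesis by linarith
    qed
  qed
  finally show ?thesis .
qed

theorem theorem3p1:
  fixes r :: real and xbar :: "'a::{real_inner,complete_space}"
  assumes "r > 0"
  shows "(norm xbar < r \<longrightarrow>
            (\<forall>y. regular_coderivative (metric_proj (cball 0 r)) xbar y = {y}))
       \<and> (xbar \<notin> cball 0 r \<longrightarrow>
            (\<forall>y. regular_coderivative (metric_proj (cball 0 r)) xbar y =
                 {(r / norm xbar) *\<^sub>R (y - (inner xbar y / (norm xbar)\<^sup>2) *\<^sub>R xbar)}))
       \<and> (norm xbar = r \<longrightarrow>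
            (\<forall>y. regular_coderivative (metric_proj (cball 0 r)) xbar y =
                 {z. inner y xbar \<le> inner z xbar \<and> inner z xbar \<le> 0 \<and>
                     y - z = (inner (y - z) xbar / (norm xbar)\<^sup>2) *\<^sub>R xbar}))"
proof (intro conjI impI allI)
  fix y
  show "regular_coderivative (metric_proj (cball 0 r)) xbar y = {y}" if "norm xbar < r"
    using that by (rule regular_coderivative_proj_inside)
  show "regular_coderivative (metric_proj (cball 0 r)) xbar y =
      {(r / norm xbar) *\<^sub>R (y - (inner xbar y / (norm xbar)\<^sup>2) *\<^sub>R xbar)}" if "xbar \<notin> cball 0 r"
    using assms that by (intro regular_coderivative_proj_outside) auto
  show "regular_coderivative (metric_proj (cball 0 r)) xbar y =
      {z. inner y xbar \<le> inner z xbar \<and> inner z xbar \<le> 0 \<and>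
          y - z = (inner (y - z) xbar / (norm xbar)\<^sup>2) *\<^sub>R xbar}" if "norm xbar = r"
    using assms that by (rule regular_coderivative_proj_boundary)
qed

end
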